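(* Assume the offer distribution satisfies $E[X_+^p]<\infty$ for some $p>1$. Then for any $\mu_0\ge 0$ (with $\mu_0<M$), the corresponding optimal policy satisfies, for all $t\ge 0$, $$\mu(t)\le\mu_0+E[(X-\mu_0)_+^p]^{\frac1p}\cdot(\lambda t)^{\frac1p}.$$
   Context: A seller receives independent offers with cumulative distribution function (CDF) $F$ on $\mathbb{R}$ (the offer distribution), arriving as a Poisson process with rate $\lambda>0$; if no offer is accepted before the deadline, the asset is sold at a random price with CDF $F_0$. $X$ and $X_0$ denote random variables with CDFs $F$ and $F_0$; $y_+=\max(y,0)$, and $y_+^p=(y_+)^p$; $\mu_0=E[X_0]$; $M=\sup\{x : F(x)<1\}\in(-\infty,+\infty]$. Standing assumptions: $E[X_+]<\infty$, $E[|X_0|]<\infty$, $0\le\mu_0<M$. Define $\phi(x)=\int_x^\infty[1-F(u)]\,du$ and $\Psi(x)=\int_{\mu_0}^x\frac{du}{\phi(u)}$ for $x\in[\mu_0,M)$. The optimal policy (the threshold function such that accepting an offer $x$ arriving when the remaining time to the deadline is $t$ if and only if $x\ge\mu(t)$ maximizes the expected sale price) is the function $\mu:[0,\infty)\to[\mu_0,M)$, $\mu(t)=\Psi^{-1}(\lambda t)$; equivalently, the solution of $\mu'(t)=\lambda\phi(\mu(t))$, $\mu(0)=\mu_0$. It depends on $F_0$ only through $\mu_0$. *)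

theory Defs
  imports "HOL-Probability.Probability"
begin

definition offer_sup :: "(real \<Rightarrow> real) \<Rightarrow> ereal" where
  "offer_sup F = (SUP x\<in>{x. F x < 1}. ereal x)"

definition offer_phi :: "(real \<Rightarrow> real) \<Rightarrow> real \<Rightarrow> real" where
  "offer_phi F x = (LBINT u:{x..}. 1 - F u)"

definition offer_Psi :: "(real \<Rightarrow> real) \<Rightarrow> real \<Rightarrow> real \<Rightarrow> real" where
  "offer_Psi F \<mu>\<^sub>0 x = (LBINT u:{\<mu>\<^sub>0..x}. 1 / offer_phi F u)"

text \<open>
  The threshold as a function of the remaining time: the inverse, evaluated at \<open>lam * t\<close>, of
  \<^const>\<open>offer_Psi\<close> as a map on \<open>[\<mu>\<^sub>0, M)\<close>, where \<open>M\<close> is \<^const>\<open>offer_sup\<close> (possibly infinite).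
  For \<open>\<mu>\<^sub>0 < M\<close> and an offer distribution whose positive part is integrable, this map is a
  bijection onto \<open>[0, \<infinity>)\<close>, so the inverse is the genuine one for all \<open>t \<ge> 0\<close>.
\<close>

definition optimal_policy :: "(real \<Rightarrow> real) \<Rightarrow> real \<Rightarrow> real \<Rightarrow> real \<Rightarrow> real" where
  "optimal_policy F \<mu>\<^sub>0 lam t =
     inv_into {x. \<mu>\<^sub>0 \<le> x \<and> ereal x < offer_sup F} (offer_Psi F \<mu>\<^sub>0) (lam * t)"

end

theory Submission
  imports Defs
begin

text \<open>
  Measure time by \<open>s = lam * t\<close>.  The optimal policy inverts \<^const>\<open>offer_Psi\<close>, so an upper bound
  for the policy amounts to a lower bound for \<^const>\<open>offer_Psi\<close>, which in turn follows from an
  upper bound for \<^const>\<open>offer_phi\<close>.  Write \<open>m\<close> for the initial threshold and \<open>A\<close> for the \<open>p\<close>-th moment of the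
  positive part of \<open>X - m\<close>.  Since \<^const>\<open>offer_phi\<close> at \<open>x\<close> is the expectation of the positive
  part of \<open>X - x\<close>, the tangent inequality for the convex function \<open>y powr p\<close> at \<open>v > 0\<close> gives
  \<open>p * v powr (p - 1) * offer_phi F (m + v) \<le> A\<close> (lemma \<open>offer_phi_moment_bound\<close>).  Its left-hand
  factor is the derivative of \<open>v powr p\<close>; integrating over \<open>{m..x}\<close> yields
  \<open>(x - m) powr p \<le> A * offer_Psi F m x\<close> (lemma \<open>offer_Psi_moment_bound\<close>).  At the policy's value
  \<open>x\<close> at time \<open>t\<close> one has \<open>offer_Psi F m x = s\<close>, and taking \<open>p\<close>-th roots gives the claim.

  That \<^const>\<open>offer_Psi\<close> really takes the value \<open>s\<close> (lemma \<open>offer_Psi_surj\<close>) must be shown, because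
  the policy is a choice-based inverse with no known value outside the range.  It follows from the
  intermediate value theorem once \<^const>\<open>offer_Psi\<close> is unbounded: for unbounded offers by the
  inequality above, and for offers bounded by a finite \<open>M\<close> by comparison of \<^const>\<open>offer_phi\<close>
  at \<open>u\<close> with \<open>M - u\<close>, whose reciprocal is not integrable up to \<open>M\<close>.
\<close>

section \<open>The expected excess of an offer over a threshold\<close>

locale offer_distribution = prob_space P
  for P :: "'a measure" +
  fixes X :: "'a \<Rightarrow> real" and F :: "real \<Rightarrow> real"
  assumes X_measurable [measurable]: "X \<in> borel_measurable P"
    and F_eq_cdf: "F = cdf (distr P borel X)"
    and integrable_pos_part: "integrable P (\<lambda>\<omega>. max (X \<omega>) 0)"
begin

lemma integrable_excess: "integrable P (\<lambda>\<omega>. max (X \<omega> - x) 0)"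
proof (rule Bochner_Integration.integrable_bound)
  show "integrable P (\<lambda>\<omega>. max (X \<omega>) 0 + \<bar>x\<bar>)"
    using integrable_pos_part by simp
qed auto

lemma tail_prob: "prob {\<omega> \<in> space P. u < X \<omega>} = 1 - F u"
proof -
  have "F u = prob {\<omega> \<in> space P. X \<omega> \<le> u}"
    unfolding F_eq_cdf cdf_def
    by (subst measure_distr) (auto intro!: arg_cong[where f = prob])
  moreover have "{\<omega> \<in> space P. u < X \<omega>} = space P - {\<omega> \<in> space P. X \<omega> \<le> u}"
    by auto
  ultimately show ?thesis
    by (simp add: prob_compl)
qed

lemma F_le_1: "F u \<le> 1"
  using tail_prob[of u] by (metis diff_ge_0_iff_ge measure_nonneg)

lemma F_measurable [measurable]: "F \<in> borel_measurable borel"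
proof -
  interpret D: real_distribution "distr P borel X"
    by (rule real_distribution_distr) measurable
  show ?thesis
    unfolding F_eq_cdf
    by (rule borel_measurable_mono) (auto simp: mono_def intro: D.cdf_nondecreasing)
qed

text \<open>
  The layer-cake identity: the excess of \<open>X\<close> over \<open>x\<close> is the length of \<open>{x..<X}\<close>, so Tonelli
  turns its expectation into the integral of the tail probabilities.  All further information
  about \<^const>\<open>offer_phi\<close> comes from the pointwise behaviour of the excess.
\<close>

lemma offer_phi_eq_expectation: "offer_phi F x = expectation (\<lambda>\<omega>. max (X \<omega> - x) 0)"
proof -
  interpret pair_sigma_finite P lborel ..
  let ?h = "\<lambda>\<omega> u. indicator {(\<omega>, u). x \<le> u \<and> u < X \<omega>} (\<omega>, u) :: ennreal"
  have over_u: "(\<integral>\<^sup>+u. ?h \<omega> u \<partial>lborel) = ennreal (max (X \<omega> - x) 0)" for \<omega>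
  proof -
    have "(\<integral>\<^sup>+u. ?h \<omega> u \<partial>lborel) = (\<integral>\<^sup>+u. indicator {x..<X \<omega>} u \<partial>lborel)"
      by (intro nn_integral_cong) (auto split: split_indicator)
    also have "\<dots> = ennreal (max (X \<omega> - x) 0)"
      by (cases "x \<le> X \<omega>") (auto simp: max_def)
    finally show ?thesis .
  qed
  have over_\<omega>: "(\<integral>\<^sup>+\<omega>. ?h \<omega> u \<partial>P) = ennreal (indicator {x..} u * (1 - F u))" for u
  proof -
    have "(\<integral>\<^sup>+\<omega>. ?h \<omega> u \<partial>P)
        = (\<integral>\<^sup>+\<omega>. indicator {x..} u * indicator {\<omega> \<in> space P. u < X \<omega>} \<omega> \<partial>P)"
      by (intro nn_integral_cong) (auto split: split_indicator)
    also have "\<dots> = indicator {x..} u * emeasure P {\<omega> \<in> space P. u < X \<omega>}"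
      by (subst nn_integral_cmult) auto
    also have "\<dots> = ennreal (indicator {x..} u * (1 - F u))"
      by (auto simp: emeasure_eq_measure tail_prob split: split_indicator)
    finally show ?thesis .
  qed
  have "(\<integral>\<^sup>+u. ennreal (indicator {x..} u * (1 - F u)) \<partial>lborel)
      = (\<integral>\<^sup>+u. (\<integral>\<^sup>+\<omega>. ?h \<omega> u \<partial>P) \<partial>lborel)"
    by (simp add: over_\<omega>)
  also have "\<dots> = (\<integral>\<^sup>+\<omega>. (\<integral>\<^sup>+u. ?h \<omega> u \<partial>lborel) \<partial>P)"
  proof (rule Fubini')
    have "{z \<in> space (P \<Otimes>\<^sub>M lborel). x \<le> snd z \<and> snd z < X (fst z)} \<in> sets (P \<Otimes>\<^sub>M lborel)"
      by measurable
    then have "(\<lambda>z. indicator {z \<in> space (P \<Otimes>\<^sub>M lborel). x \<le> snd z \<and> snd z < X (fst z)} z :: ennreal)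
        \<in> borel_measurable (P \<Otimes>\<^sub>M lborel)"
      by (rule borel_measurable_indicator)
    then show "(\<lambda>(\<omega>, u). ?h \<omega> u) \<in> borel_measurable (P \<Otimes>\<^sub>M lborel)"
      by (rule measurable_cong[THEN iffD1, rotated])
         (auto simp: space_pair_measure split: split_indicator)
  qed
  also have "\<dots> = (\<integral>\<^sup>+\<omega>. ennreal (max (X \<omega> - x) 0) \<partial>P)"
    by (simp add: over_u)
  also have "\<dots> = ennreal (expectation (\<lambda>\<omega>. max (X \<omega> - x) 0))"
    by (intro nn_integral_eq_integral integrable_excess) auto
  finally have nn: "(\<integral>\<^sup>+u. ennreal (indicator {x..} u * (1 - F u)) \<partial>lborel)
      = ennreal (expectation (\<lambda>\<omega>. max (X \<omega> - x) 0))" .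
  have "has_bochner_integral lborel (\<lambda>u. indicator {x..} u * (1 - F u))
      (expectation (\<lambda>\<omega>. max (X \<omega> - x) 0))"
    by (rule has_bochner_integral_nn_integral)
       (auto simp: nn F_le_1 intro!: integral_nonneg_AE)
  then show ?thesis
    by (simp add: offer_phi_def set_lebesgue_integral_def has_bochner_integral_iff)
qed

lemma offer_phi_le_add_dist: "offer_phi F x \<le> offer_phi F y + \<bar>x - y\<bar>"
proof -
  have "offer_phi F x \<le> expectation (\<lambda>\<omega>. max (X \<omega> - y) 0 + \<bar>x - y\<bar>)"
    unfolding offer_phi_eq_expectation
    by (intro integral_mono integrable_excess Bochner_Integration.integrable_add) auto
  also have "\<dots> = offer_phi F y + \<bar>x - y\<bar>"
    by (simp add: offer_phi_eq_expectation integrable_excess prob_space)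
  finally show ?thesis .
qed

lemma continuous_on_offer_phi: "continuous_on S (offer_phi F)"
proof (rule lipschitz_on_continuous_on)
  show "1-lipschitz_on S (offer_phi F)"
  proof (rule lipschitz_onI)
    fix x y
    show "dist (offer_phi F x) (offer_phi F y) \<le> 1 * dist x y"
      using offer_phi_le_add_dist[of x y] offer_phi_le_add_dist[of y x]
      by (simp add: dist_real_def)
  qed simp
qed

lemma offer_phi_pos:
  assumes "ereal x < offer_sup F"
  shows "0 < offer_phi F x"
proof -
  obtain y where y: "F y < 1" "x < y"
    using assms by (auto simp: offer_sup_def less_SUP_iff)
  have "0 < (y - x) * prob {\<omega> \<in> space P. y < X \<omega>}"
    using y by (simp add: tail_prob)
  also have "\<dots> = expectation (\<lambda>\<omega>. (y - x) * indicator {\<omega> \<in> space P. y < X \<omega>} \<omega>)"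
    by simp
  also have "\<dots> \<le> offer_phi F x"
    unfolding offer_phi_eq_expectation using y
    by (intro integral_mono integrable_excess integrable_mult_right integrable_real_indicator)
       (auto split: split_indicator simp: emeasure_eq_measure)
  finally show ?thesis .
qed

text \<open>
  Where offers are bounded by a finite \<open>M\<close>, the expected excess vanishes at \<open>M\<close>, and being
  1-Lipschitz it can be no larger than the distance to \<open>M\<close>.
\<close>

lemma offer_phi_le_dist_sup:
  assumes "offer_sup F = ereal M" and "x \<le> M"
  shows "offer_phi F x \<le> M - x"
proof -
  have F1: "F u = 1" if "M < u" for u
  proof (rule antisym[OF F_le_1], rule ccontr)
    assume "\<not> 1 \<le> F u"
    then have "ereal u \<le> offer_sup F"
      unfolding offer_sup_def by (intro SUP_upper) auto
    with that assms show False by simp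
  qed
  have "AE u in lborel. indicator {M..} u *\<^sub>R (1 - F u) = 0"
    using AE_lborel_singleton[of M]
    by eventually_elim (use F1 in \<open>auto split: split_indicator\<close>)
  then have "offer_phi F M = 0"
    unfolding offer_phi_def set_lebesgue_integral_def by (rule integral_eq_zero_AE)
  with offer_phi_le_add_dist[of x M] assms show ?thesis by simp
qed

section \<open>The time needed to reach a threshold\<close>

lemma continuous_on_inverse_offer_phi:
  assumes "ereal x < offer_sup F"
  shows "continuous_on {m..x} (\<lambda>u. 1 / offer_phi F u)"
proof (intro continuous_intros continuous_on_offer_phi ballI)
  fix u assume "u \<in> {m..x}"
  then have "ereal u \<le> ereal x"
    by simp
  then have "ereal u < offer_sup F"
    using assms by (rule le_less_trans)
  then show "offer_phi F u \<noteq> 0"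
    using offer_phi_pos[of u] by simp
qed

lemma offer_Psi_eq_integral:
  assumes "ereal x < offer_sup F"
  shows "offer_Psi F m x = integral {m..x} (\<lambda>u. 1 / offer_phi F u)"
  unfolding offer_Psi_def
  by (intro set_borel_integral_eq_integral borel_integrable_atLeastAtMost'
      continuous_on_inverse_offer_phi assms)

lemma continuous_on_offer_Psi:
  assumes "ereal x < offer_sup F"
  shows "continuous_on {m..x} (offer_Psi F m)"
proof -
  have "continuous_on {m..x} (\<lambda>y. integral {m..y} (\<lambda>u. 1 / offer_phi F u))"
    by (intro indefinite_integral_continuous_1 integrable_continuous_real
        continuous_on_inverse_offer_phi assms)
  moreover have "ereal y < offer_sup F" if "y \<in> {m..x}" for y
    using that assms le_less_trans[of "ereal y" "ereal x"] by auto
  ultimately show ?thesis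
    by (elim continuous_on_eq) (simp add: offer_Psi_eq_integral)
qed

text \<open>
  An upper bound \<open>1 / g\<close> for \<^const>\<open>offer_phi\<close> becomes a lower bound for \<^const>\<open>offer_Psi\<close>
  by integrating \<open>g \<le> 1 / offer_phi F\<close>.  Only the open interval matters, so
  the moment bound below, available strictly above \<open>m\<close>, can be used as \<open>le\<close>.
\<close>

lemma offer_Psi_lower_bound:
  assumes x: "m \<le> x" "ereal x < offer_sup F"
    and G: "continuous_on {m..x} G"
    and deriv: "\<And>u. m < u \<Longrightarrow> u < x \<Longrightarrow> (G has_real_derivative g u) (at u)"
    and le: "\<And>u. m < u \<Longrightarrow> u < x \<Longrightarrow> g u * offer_phi F u \<le> 1"
  shows "G x - G m \<le> offer_Psi F m x"
proof -
  have g: "(g has_integral (G x - G m)) {m..x}"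
    using x G deriv
    by (intro fundamental_theorem_of_calculus_interior)
       (auto simp: has_real_derivative_iff_has_vector_derivative)
  have \<Psi>: "((\<lambda>u. 1 / offer_phi F u) has_integral offer_Psi F m x) {m..x}"
    unfolding offer_Psi_eq_integral[OF x(2)]
    by (intro integrable_integral integrable_continuous_real continuous_on_inverse_offer_phi x)
  show ?thesis
  proof (rule has_integral_le[of g _ "{m<..<x}" "\<lambda>u. 1 / offer_phi F u"])
    show "(g has_integral (G x - G m)) {m<..<x}"
      using g by (simp add: has_integral_Icc_iff_Ioo)
    show "((\<lambda>u. 1 / offer_phi F u) has_integral offer_Psi F m x) {m<..<x}"
      using \<Psi> by (simp add: has_integral_Icc_iff_Ioo)
    fix u assume u: "u \<in> {m<..<x}"
    then have "ereal u < offer_sup F"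
      using x le_less_trans[of "ereal u" "ereal x"] by auto
    then show "g u \<le> 1 / offer_phi F u"
      using offer_phi_pos[of u] le[of u] u by (simp add: field_simps)
  qed
qed

section \<open>The moment bound\<close>

lemma integrable_excess_powr:
  assumes "0 \<le> m" "1 < p" "integrable P (\<lambda>\<omega>. max (X \<omega>) 0 powr p)"
  shows "integrable P (\<lambda>\<omega>. max (X \<omega> - m) 0 powr p)"
  using assms(3)
  by (rule Bochner_Integration.integrable_bound)
     (use assms in \<open>auto intro!: AE_I2 powr_mono2\<close>)

end

lemma powr_ge_tangent:
  fixes y v p :: real
  assumes "0 \<le> y" "0 < v" "1 < p"
  shows "p * v powr (p - 1) * (y - v) \<le> y powr p"
proof (cases "y = 0")
  case False
  have "p * v powr (p - 1) * (y - v) \<le> y powr p - v powr p"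
    using assms False
    by (intro convex_on_imp_above_tangent[of "{0<..}"] powr_convex)
       (auto simp: interior_open intro!: derivative_eq_intros)
  then show ?thesis
    using powr_ge_zero[of v p] by linarith
qed (use assms in simp)

context offer_distribution
begin

text \<open>
  The tangent to \<open>y powr p\<close> at \<open>v\<close> bounds the linear excess over \<open>m + v\<close> by the \<open>p\<close>-th
  power of the excess over \<open>m\<close>.  The factor \<open>p * v powr (p - 1)\<close> is the derivative
  of \<open>v powr p\<close>, so the bound integrates exactly.
\<close>

lemma offer_phi_moment_bound:
  assumes "0 < v" "1 < p" and int: "integrable P (\<lambda>\<omega>. max (X \<omega> - m) 0 powr p)"
  shows "p * v powr (p - 1) * offer_phi F (m + v)
    \<le> expectation (\<lambda>\<omega>. max (X \<omega> - m) 0 powr p)"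
proof -
  let ?c = "p * v powr (p - 1)"
  have "?c * max (X \<omega> - (m + v)) 0 \<le> max (X \<omega> - m) 0 powr p" for \<omega>
  proof (cases "m + v \<le> X \<omega>")
    case True
    then show ?thesis
      using powr_ge_tangent[of "X \<omega> - m" v p] assms by (simp add: max_def algebra_simps)
  qed (simp add: max_def)
  then have "expectation (\<lambda>\<omega>. ?c * max (X \<omega> - (m + v)) 0)
      \<le> expectation (\<lambda>\<omega>. max (X \<omega> - m) 0 powr p)"
    by (intro integral_mono int integrable_mult_right integrable_excess)
  then show ?thesis
    by (simp add: offer_phi_eq_expectation)
qed

lemma moment_pos:
  assumes "ereal m < offer_sup F" "1 < p"
    and int: "integrable P (\<lambda>\<omega>. max (X \<omega> - m) 0 powr p)"
  shows "0 < expectation (\<lambda>\<omega>. max (X \<omega> - m) 0 powr p)"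
proof -
  obtain y where y: "F y < 1" "m < y"
    using assms by (auto simp: offer_sup_def less_SUP_iff)
  \<comment> \<open>stop short of \<open>y\<close> to lie strictly below \<^const>\<open>offer_sup\<close>\<close>
  define z where "z = (m + y) / 2"
  have z: "m < z" "z < y" using y by (auto simp: z_def)
  then have "ereal z < offer_sup F"
    using y by (auto simp: offer_sup_def less_SUP_iff)
  then have "0 < p * (z - m) powr (p - 1) * offer_phi F (m + (z - m))"
    using z assms by (simp add: offer_phi_pos)
  also have "\<dots> \<le> expectation (\<lambda>\<omega>. max (X \<omega> - m) 0 powr p)"
    using z assms by (intro offer_phi_moment_bound) auto
  finally show ?thesis .
qed

lemma offer_Psi_moment_bound:
  assumes x: "m \<le> x" "ereal x < offer_sup F" and p: "1 < p"
    and int: "integrable P (\<lambda>\<omega>. max (X \<omega> - m) 0 powr p)"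
  shows "(x - m) powr p \<le> expectation (\<lambda>\<omega>. max (X \<omega> - m) 0 powr p) * offer_Psi F m x"
proof -
  define A where "A = expectation (\<lambda>\<omega>. max (X \<omega> - m) 0 powr p)"
  have "ereal m < offer_sup F"
    using x le_less_trans[of "ereal m" "ereal x"] by auto
  then have A: "0 < A"
    unfolding A_def using p int by (rule moment_pos)
  have "(x - m) powr p / A - (m - m) powr p / A \<le> offer_Psi F m x"
  proof (rule offer_Psi_lower_bound[where g = "\<lambda>u. p * (u - m) powr (p - 1) / A"])
    show "continuous_on {m..x} (\<lambda>u. (u - m) powr p / A)"
      using p A by (intro continuous_intros continuous_on_powr') auto
    fix u assume u: "m < u" "u < x"
    show "((\<lambda>u. (u - m) powr p / A) has_real_derivative p * (u - m) powr (p - 1) / A) (at u)"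
      using u A by (auto intro!: derivative_eq_intros)
    show "p * (u - m) powr (p - 1) / A * offer_phi F u \<le> 1"
      using offer_phi_moment_bound[of "u - m" p m] u p int A by (simp add: A_def)
  qed (use x in auto)
  then show ?thesis
    using A p by (simp add: A_def field_simps)
qed

section \<open>Every remaining time is attained\<close>

text \<open>
  If offers are unbounded, the moment bound itself makes \<^const>\<open>offer_Psi\<close> large; if they are
  bounded by \<open>M\<close>, comparison with \<open>M - u\<close> gives a logarithm that diverges at \<open>M\<close>.
\<close>

lemma offer_Psi_unbounded:
  assumes m: "ereal m < offer_sup F" and p: "1 < p"
    and int: "integrable P (\<lambda>\<omega>. max (X \<omega> - m) 0 powr p)" and s: "0 \<le> s"
  obtains x where "m \<le> x" "ereal x < offer_sup F" "s \<le> offer_Psi F m x"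
proof (cases "offer_sup F")
  case PInf
  define A where "A = expectation (\<lambda>\<omega>. max (X \<omega> - m) 0 powr p)"
  define x where "x = m + (A * s) powr (1 / p)"
  have A: "0 < A"
    unfolding A_def using m p int by (rule moment_pos)
  have "A * s = (x - m) powr p"
    using A s p by (simp add: x_def powr_powr)
  also have "\<dots> \<le> A * offer_Psi F m x"
    unfolding A_def using PInf p int by (intro offer_Psi_moment_bound) (auto simp: x_def)
  finally show ?thesis
    using A PInf by (intro that[of x]) (auto simp: x_def)
next
  case (real M)
  \<comment> \<open>the point where the logarithmic lower bound \<open>ln (M - m) - ln (M - x)\<close> equals \<open>s\<close>\<close>
  define x where "x = M - (M - m) * exp (- s)"
  have mM: "m < M"
    using m real by simp
  have "(M - m) * exp (- s) \<le> (M - m) * 1"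
    using mM s by (intro mult_left_mono) auto
  moreover have "0 < (M - m) * exp (- s)"
    using mM by simp
  ultimately have x: "m \<le> x" "x < M"
    by (simp_all add: x_def)
  have "- ln (M - x) - (- ln (M - m)) \<le> offer_Psi F m x"
  proof (rule offer_Psi_lower_bound[where g = "\<lambda>u. 1 / (M - u)"])
    show "continuous_on {m..x} (\<lambda>u. - ln (M - u))"
      using x by (intro continuous_intros) auto
    fix u assume u: "m < u" "u < x"
    show "((\<lambda>u. - ln (M - u)) has_real_derivative 1 / (M - u)) (at u)"
      using u x by (auto intro!: derivative_eq_intros)
    show "1 / (M - u) * offer_phi F u \<le> 1"
      using offer_phi_le_dist_sup[OF real, of u] u x by simp
  qed (use x real in auto)
  moreover have "ln (M - x) = ln (M - m) - s"
    using mM by (simp add: x_def ln_mult)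
  ultimately show ?thesis
    using x real by (intro that[of x]) auto
qed (use m in auto)

lemma offer_Psi_surj:
  assumes m: "ereal m < offer_sup F" and p: "1 < p"
    and int: "integrable P (\<lambda>\<omega>. max (X \<omega> - m) 0 powr p)" and s: "0 \<le> s"
  shows "s \<in> offer_Psi F m ` {x. m \<le> x \<and> ereal x < offer_sup F}"
proof -
  obtain b where b: "m \<le> b" "ereal b < offer_sup F" "s \<le> offer_Psi F m b"
    using offer_Psi_unbounded[OF assms] by blast
  have "offer_Psi F m m = 0"
    using m by (simp add: offer_Psi_eq_integral)
  then obtain x where x: "m \<le> x" "x \<le> b" "offer_Psi F m x = s"
    using IVT'[of "offer_Psi F m" m s b] b s continuous_on_offer_Psi by auto
  moreover have "ereal x < offer_sup F"
    using x b le_less_trans[of "ereal x" "ereal b"] by auto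
  ultimately show ?thesis
    by auto
qed

end

theorem theorem2p3:
  fixes F F\<^sub>0 :: "real \<Rightarrow> real"
    and P :: "'a measure" and X :: "'a \<Rightarrow> real"
    and P\<^sub>0 :: "'b measure" and X\<^sub>0 :: "'b \<Rightarrow> real"
    and lam \<mu>\<^sub>0 p :: real
  assumes "prob_space P" and "X \<in> borel_measurable P"
    and "F = cdf (distr P borel X)"
    and "prob_space P\<^sub>0" and "X\<^sub>0 \<in> borel_measurable P\<^sub>0"
    and "F\<^sub>0 = cdf (distr P\<^sub>0 borel X\<^sub>0)"
    and "lam > 0"
    and "integrable P (\<lambda>\<omega>. max (X \<omega>) 0)"
    and "integrable P\<^sub>0 (\<lambda>\<omega>. \<bar>X\<^sub>0 \<omega>\<bar>)"
    and "\<mu>\<^sub>0 = prob_space.expectation P\<^sub>0 X\<^sub>0"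
    and "0 \<le> \<mu>\<^sub>0" and "ereal \<mu>\<^sub>0 < offer_sup F"
    and "p > 1" and "integrable P (\<lambda>\<omega>. max (X \<omega>) 0 powr p)"
  shows "\<forall>t\<ge>0. optimal_policy F \<mu>\<^sub>0 lam t
     \<le> \<mu>\<^sub>0 + prob_space.expectation P (\<lambda>\<omega>. max (X \<omega> - \<mu>\<^sub>0) 0 powr p) powr (1 / p)
             * (lam * t) powr (1 / p)"
proof (intro allI impI)
  fix t :: real assume t: "0 \<le> t"
  interpret offer_distribution P X F
    using assms by (simp add: offer_distribution_def offer_distribution_axioms_def)
  define A where "A = expectation (\<lambda>\<omega>. max (X \<omega> - \<mu>\<^sub>0) 0 powr p)"
  define x where "x = optimal_policy F \<mu>\<^sub>0 lam t"
  have int: "integrable P (\<lambda>\<omega>. max (X \<omega> - \<mu>\<^sub>0) 0 powr p)"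
    using assms by (intro integrable_excess_powr)
  have A: "0 < A"
    unfolding A_def using assms int by (intro moment_pos)
  have s: "0 \<le> lam * t"
    using assms t by simp
  have range: "lam * t \<in> offer_Psi F \<mu>\<^sub>0 ` {x. \<mu>\<^sub>0 \<le> x \<and> ereal x < offer_sup F}"
    using assms int s by (intro offer_Psi_surj)
  have \<Psi>: "offer_Psi F \<mu>\<^sub>0 x = lam * t"
    unfolding x_def optimal_policy_def using range by (rule f_inv_into_f)
  have x: "\<mu>\<^sub>0 \<le> x" "ereal x < offer_sup F"
    using inv_into_into[OF range] by (auto simp: x_def optimal_policy_def)
  have "(x - \<mu>\<^sub>0) powr p \<le> A * (lam * t)"
    using offer_Psi_moment_bound[OF x \<open>p > 1\<close> int] by (simp add: A_def \<Psi>)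
  then have "((x - \<mu>\<^sub>0) powr p) powr (1 / p) \<le> (A * (lam * t)) powr (1 / p)"
    using \<open>p > 1\<close> by (intro powr_mono2) auto
  then have "x - \<mu>\<^sub>0 \<le> A powr (1 / p) * (lam * t) powr (1 / p)"
    using x A s \<open>p > 1\<close> by (simp add: powr_powr powr_mult)
  then show "optimal_policy F \<mu>\<^sub>0 lam t \<le> \<mu>\<^sub>0
      + expectation (\<lambda>\<omega>. max (X \<omega> - \<mu>\<^sub>0) 0 powr p) powr (1 / p) * (lam * t) powr (1 / p)"
    by (simp add: A_def x_def)
qed

end
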